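(* Let $G$ be an abelian group of order $n$ (a positive integer). For a prime $p$, let $G_p$ denote the Sylow $p$-subgroup of $G$. Suppose that $|G_p|\leq p^5$ for every prime divisor $p$ of $n$, and that $G_2$ is isomorphic to $C_4$ or to $C_2^k$ for some integer $0\leq k\leq 5$. Then $G$ is an $\mathrm{NCI}^{(2)}$-group.
   Context: $C_n$ denotes the cyclic group of order $n$. Let $G$ be a finite group and $\mathrm{Sym}(G)$ the group of all permutations of the set $G$. Let $G_r\leq \mathrm{Sym}(G)$ be the group of all right translations $x\mapsto xg$, $g\in G$, and let $\mathrm{Hol}(G)=N_{\mathrm{Sym}(G)}(G_r)=G_r\rtimes \mathrm{Aut}(G)$. For $K\leq \mathrm{Sym}(G)$, the 2-closure $K^{(2)}$ is the largest subgroup of $\mathrm{Sym}(G)$ having the same orbits on $G\times G$ (under componentwise action) as $K$; $K$ is 2-closed if $K^{(2)}=K$. A subgroup of $\mathrm{Sym}(G)$ is $G$-regular if it is regular on $G$ and isomorphic to $G$. A group $K$ with $G_r\leq K\leq \mathrm{Sym}(G)$ is $G$-transjugate if every $G$-regular subgroup of $K$ is conjugate in $K$ to $G_r$. The group $G$ is an $\mathrm{NCI}^{(2)}$-group if every 2-closed group $K$ with $G_r\leq K\leq \mathrm{Hol}(G)$ is $G$-transjugate. *)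

theory Defs
  imports "HOL-Algebra.Algebra"
begin

section \<open>Permutation groups and 2-closure\<close>

text \<open>The group \<open>Sym(\<Omega>)\<close> is \<^term>\<open>BijGroup \<Omega>\<close>; its elements are the bijections of \<open>\<Omega>\<close> that are
  extensional on \<open>\<Omega>\<close>, multiplied by \<^term>\<open>compose \<Omega> g f\<close> (first \<open>f\<close>, then \<open>g\<close>).
  A permutation group on \<open>\<Omega>\<close> is represented by its set of elements \<open>K\<close>.\<close>

definition pair_action :: "'a set \<Rightarrow> ('a \<Rightarrow> 'a) \<Rightarrow> 'a \<times> 'a \<Rightarrow> 'a \<times> 'a" where
  "pair_action \<Omega> f = (\<lambda>(x, y) \<in> \<Omega> \<times> \<Omega>. (f x, f y))"

definition orbitals :: "'a set \<Rightarrow> ('a \<Rightarrow> 'a) set \<Rightarrow> ('a \<times> 'a) set set" where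
  "orbitals \<Omega> K = orbits (BijGroup \<Omega>\<lparr>carrier := K\<rparr>) (\<Omega> \<times> \<Omega>) (pair_action \<Omega>)"

text \<open>The order on sets is inclusion; the lemma \<open>two_closure_is_greatest\<close> below shows that the
  greatest element exists.\<close>

definition two_closure :: "'a set \<Rightarrow> ('a \<Rightarrow> 'a) set \<Rightarrow> ('a \<Rightarrow> 'a) set" where
  "two_closure \<Omega> K =
     (GREATEST L. subgroup L (BijGroup \<Omega>) \<and> orbitals \<Omega> L = orbitals \<Omega> K)"

definition two_closed :: "'a set \<Rightarrow> ('a \<Rightarrow> 'a) set \<Rightarrow> bool" where
  "two_closed \<Omega> K \<longleftrightarrow> subgroup K (BijGroup \<Omega>) \<and> two_closure \<Omega> K = K"

definition regular_on :: "'a set \<Rightarrow> ('a \<Rightarrow> 'a) set \<Rightarrow> bool" where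
  "regular_on \<Omega> H \<longleftrightarrow>
     transitive_action (BijGroup \<Omega>\<lparr>carrier := H\<rparr>) \<Omega> (\<lambda>f. f) \<and>
     (\<forall>x\<in>\<Omega>. stabilizer (BijGroup \<Omega>\<lparr>carrier := H\<rparr>) (\<lambda>f. f) x = {\<one>\<^bsub>BijGroup \<Omega>\<^esub>})"


section \<open>The holomorph and NCI(2)-groups\<close>

definition right_translations :: "('a, 'b) monoid_scheme \<Rightarrow> ('a \<Rightarrow> 'a) set" where
  "right_translations G = {\<lambda>x\<in>carrier G. x \<otimes>\<^bsub>G\<^esub> g | g. g \<in> carrier G}"

definition holomorph :: "('a, 'b) monoid_scheme \<Rightarrow> ('a \<Rightarrow> 'a) set" where
  "holomorph G = normalizer (BijGroup (carrier G)) (right_translations G)"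

definition G_regular :: "('a, 'b) monoid_scheme \<Rightarrow> ('a \<Rightarrow> 'a) set \<Rightarrow> bool" where
  "G_regular G H \<longleftrightarrow>
     subgroup H (BijGroup (carrier G)) \<and> regular_on (carrier G) H \<and>
     BijGroup (carrier G)\<lparr>carrier := H\<rparr> \<cong> G"

definition G_transjugate :: "('a, 'b) monoid_scheme \<Rightarrow> ('a \<Rightarrow> 'a) set \<Rightarrow> bool" where
  "G_transjugate G K \<longleftrightarrow>
     (\<forall>H. H \<subseteq> K \<and> G_regular G H \<longrightarrow>
        (\<exists>k\<in>K. H = k <#\<^bsub>BijGroup (carrier G)\<^esub> right_translations G
                      #>\<^bsub>BijGroup (carrier G)\<^esub> inv\<^bsub>BijGroup (carrier G)\<^esub> k))"

definition NCI2_group :: "('a, 'b) monoid_scheme \<Rightarrow> bool" where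
  "NCI2_group G \<longleftrightarrow>
     group G \<and> finite (carrier G) \<and>
     (\<forall>K. subgroup K (BijGroup (carrier G)) \<and> two_closed (carrier G) K \<and>
          right_translations G \<subseteq> K \<and> K \<subseteq> holomorph G \<longrightarrow> G_transjugate G K)"


section \<open>Sylow subgroups\<close>

text \<open>If \<open>p\<close> does not divide the order of \<open>G\<close>, the Sylow \<open>p\<close>-subgroup is trivial.\<close>

definition sylow_subgroup :: "nat \<Rightarrow> 'a set \<Rightarrow> ('a, 'b) monoid_scheme \<Rightarrow> bool" where
  "sylow_subgroup p P G \<longleftrightarrow> subgroup P G \<and> card P = p ^ multiplicity p (order G)"


section \<open>Existence of the 2-closure\<close>

lemma BijGroup_simps:
  "carrier (BijGroup \<Omega>) = Bij \<Omega>"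
  "f \<in> Bij \<Omega> \<Longrightarrow> g \<in> Bij \<Omega> \<Longrightarrow> g \<otimes>\<^bsub>BijGroup \<Omega>\<^esub> f = compose \<Omega> g f"
  "\<one>\<^bsub>BijGroup \<Omega>\<^esub> = (\<lambda>x\<in>\<Omega>. x)"
  by (simp_all add: BijGroup_def)

lemma mem_orbitals_iff:
  "A \<in> orbitals \<Omega> K \<longleftrightarrow> (\<exists>x\<in>\<Omega>. \<exists>y\<in>\<Omega>. A = {(k x, k y) | k. k \<in> K})"
  unfolding orbitals_def orbits_def orbit_def pair_action_def
  by (fastforce simp: restrict_def)

lemma Bij_apply: "f \<in> Bij \<Omega> \<Longrightarrow> x \<in> \<Omega> \<Longrightarrow> f x \<in> \<Omega>"
  using Bij_imp_funcset by blast

lemma subgroup_Bij_inverse: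
  assumes "subgroup K (BijGroup \<Omega>)" "k \<in> K"
  obtains k' where "k' \<in> K" "\<And>x. x \<in> \<Omega> \<Longrightarrow> k' (k x) = x" "\<And>x. x \<in> \<Omega> \<Longrightarrow> k (k' x) = x"
proof -
  interpret group "BijGroup \<Omega>" by (rule group_BijGroup)
  let ?i = "inv\<^bsub>BijGroup \<Omega>\<^esub> k"
  have k: "k \<in> Bij \<Omega>" and i: "?i \<in> K" "?i \<in> Bij \<Omega>"
    using assms subgroup.subset[OF assms(1)] subgroup.m_inv_closed[OF assms]
    by (auto simp: BijGroup_simps)
  have "?i \<otimes>\<^bsub>BijGroup \<Omega>\<^esub> k = \<one>\<^bsub>BijGroup \<Omega>\<^esub>" "k \<otimes>\<^bsub>BijGroup \<Omega>\<^esub> ?i = \<one>\<^bsub>BijGroup \<Omega>\<^esub>"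
    using k by (simp_all add: BijGroup_simps(1))
  hence e: "compose \<Omega> ?i k = (\<lambda>x\<in>\<Omega>. x)" "compose \<Omega> k ?i = (\<lambda>x\<in>\<Omega>. x)"
    using k i by (simp_all add: BijGroup_simps)
  show thesis
  proof (rule that[OF i(1)])
    show "?i (k x) = x" if "x \<in> \<Omega>" for x
      using fun_cong[OF e(1), of x] that by (simp add: compose_def)
    show "k (?i x) = x" if "x \<in> \<Omega>" for x
      using fun_cong[OF e(2), of x] that by (simp add: compose_def)
  qed
qed

lemma subgroup_Bij_compose:
  assumes "subgroup K (BijGroup \<Omega>)" "k \<in> K" "l \<in> K"
  shows "compose \<Omega> k l \<in> K"
proof -
  have "k \<in> Bij \<Omega>" "l \<in> Bij \<Omega>"
    using assms subgroup.subset[OF assms(1)] by (auto simp: BijGroup_simps)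
  thus ?thesis
    using subgroup.m_closed[OF assms] by (simp add: BijGroup_simps)
qed

lemma two_closure_is_greatest:
  assumes K: "subgroup K (BijGroup \<Omega>)"
  defines "C \<equiv> {f \<in> Bij \<Omega>. \<forall>x\<in>\<Omega>. \<forall>y\<in>\<Omega>. \<exists>k\<in>K. f x = k x \<and> f y = k y}"
  shows "subgroup C (BijGroup \<Omega>)" "orbitals \<Omega> C = orbitals \<Omega> K"
    and "\<And>L. subgroup L (BijGroup \<Omega>) \<Longrightarrow> orbitals \<Omega> L = orbitals \<Omega> K \<Longrightarrow> L \<subseteq> C"
    and "two_closure \<Omega> K = C"
proof -
  interpret S: group "BijGroup \<Omega>" by (rule group_BijGroup)
  have KB: "K \<subseteq> Bij \<Omega>"
    using subgroup.subset[OF K] by (simp add: BijGroup_simps)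
  have KC: "K \<subseteq> C"
    using KB by (auto simp: C_def)
  show sub: "subgroup C (BijGroup \<Omega>)"
  proof (rule S.subgroupI)
    show "C \<subseteq> carrier (BijGroup \<Omega>)" by (auto simp: C_def BijGroup_simps)
    show "C \<noteq> {}" using KC subgroup.one_closed[OF K] by blast
  next
    fix f assume f: "f \<in> C"
    hence fB: "f \<in> Bij \<Omega>" by (simp add: C_def)
    let ?g = "inv\<^bsub>BijGroup \<Omega>\<^esub> f"
    have gB: "?g \<in> Bij \<Omega>"
      using S.inv_closed fB by (simp add: BijGroup_simps)
    have "f \<otimes>\<^bsub>BijGroup \<Omega>\<^esub> ?g = \<one>\<^bsub>BijGroup \<Omega>\<^esub>"
      using fB by (simp add: BijGroup_simps(1))
    hence e: "compose \<Omega> f ?g = (\<lambda>x\<in>\<Omega>. x)"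
      using fB gB by (simp add: BijGroup_simps)
    have fg: "f (?g x) = x" if "x \<in> \<Omega>" for x
      using fun_cong[OF e, of x] that by (simp add: compose_def)
    have "\<exists>k\<in>K. ?g x = k x \<and> ?g y = k y" if xy: "x \<in> \<Omega>" "y \<in> \<Omega>" for x y
    proof -
      have gx: "?g x \<in> \<Omega>" "?g y \<in> \<Omega>" using gB xy by (auto intro: Bij_apply)
      then obtain k where k: "k \<in> K" "f (?g x) = k (?g x)" "f (?g y) = k (?g y)"
        using f unfolding C_def by blast
      obtain k' where "k' \<in> K" "\<And>x. x \<in> \<Omega> \<Longrightarrow> k' (k x) = x"
        using subgroup_Bij_inverse[OF K k(1)] by metis
      with k fg xy gx show ?thesis by metis
    qed
    thus "?g \<in> C" using gB by (simp add: C_def)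
  next
    fix f g assume f: "f \<in> C" and g: "g \<in> C"
    hence B: "f \<in> Bij \<Omega>" "g \<in> Bij \<Omega>" by (simp_all add: C_def)
    have "\<exists>k\<in>K. compose \<Omega> f g x = k x \<and> compose \<Omega> f g y = k y"
      if xy: "x \<in> \<Omega>" "y \<in> \<Omega>" for x y
    proof -
      obtain k where k: "k \<in> K" "g x = k x" "g y = k y"
        using g xy unfolding C_def by blast
      have "g x \<in> \<Omega>" "g y \<in> \<Omega>" using B xy by (auto intro: Bij_apply)
      then obtain l where l: "l \<in> K" "f (g x) = l (g x)" "f (g y) = l (g y)"
        using f unfolding C_def by blast
      show ?thesis
        using subgroup_Bij_compose[OF K l(1) k(1)] k l xy
        by (intro bexI[of _ "compose \<Omega> l k"]) (simp_all add: compose_def)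
    qed
    thus "f \<otimes>\<^bsub>BijGroup \<Omega>\<^esub> g \<in> C"
      using B by (simp add: BijGroup_simps C_def compose_Bij)
  qed
  have "{(k x, k y) | k. k \<in> C} = {(k x, k y) | k. k \<in> K}" if "x \<in> \<Omega>" "y \<in> \<Omega>" for x y
  proof
    show "{(k x, k y) | k. k \<in> C} \<subseteq> {(k x, k y) | k. k \<in> K}"
      using that unfolding C_def by fastforce
    show "{(k x, k y) | k. k \<in> K} \<subseteq> {(k x, k y) | k. k \<in> C}"
      using KC by blast
  qed
  thus orb: "orbitals \<Omega> C = orbitals \<Omega> K"
    by (simp add: set_eq_iff[of "orbitals \<Omega> C"] mem_orbitals_iff cong: bex_cong)
  show max: "L \<subseteq> C"
    if L: "subgroup L (BijGroup \<Omega>)" and eq: "orbitals \<Omega> L = orbitals \<Omega> K" for L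
  proof
    fix f assume f: "f \<in> L"
    hence fB: "f \<in> Bij \<Omega>" using subgroup.subset[OF L] by (auto simp: BijGroup_simps)
    have "\<exists>k\<in>K. f x = k x \<and> f y = k y" if xy: "x \<in> \<Omega>" "y \<in> \<Omega>" for x y
    proof -
      let ?A = "{(l x, l y) | l. l \<in> L}"
      have "?A \<in> orbitals \<Omega> K"
        unfolding eq[symmetric] mem_orbitals_iff using xy by blast
      then obtain u v where uv: "u \<in> \<Omega>" "v \<in> \<Omega>" "?A = {(k u, k v) | k. k \<in> K}"
        unfolding mem_orbitals_iff by blast
      have "(\<lambda>x\<in>\<Omega>. x) \<in> L"
        using subgroup.one_closed[OF L] by (simp add: BijGroup_simps)
      hence "(x, y) \<in> ?A" using xy by (intro CollectI exI[of _ "\<lambda>x\<in>\<Omega>. x"]) simp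
      moreover have "(f x, f y) \<in> ?A" using f by blast
      ultimately obtain k l where kl: "k \<in> K" "x = k u" "y = k v" "l \<in> K" "f x = l u" "f y = l v"
        unfolding uv(3) by blast
      obtain k' where k': "k' \<in> K" "\<And>x. x \<in> \<Omega> \<Longrightarrow> k' (k x) = x"
        using subgroup_Bij_inverse[OF K kl(1)] by metis
      have "compose \<Omega> l k' x = f x" "compose \<Omega> l k' y = f y"
        using kl k' xy uv by (simp_all add: compose_def)
      thus ?thesis using subgroup_Bij_compose[OF K kl(4) k'(1)] by metis
    qed
    thus "f \<in> C" using fB by (simp add: C_def)
  qed
  show "two_closure \<Omega> K = C"
    unfolding two_closure_def using sub orb max by (intro Greatest_equality) auto
qed

end

theory Submission
  imports Defs
begin

text \<open>
  Let \<open>G\<^sub>r \<le> K \<le> Hol(G)\<close> with \<open>K\<close> 2-closed, and let \<open>H \<le> K\<close> be \<open>G\<close>-regular. Since \<open>K\<close> normalises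
  \<open>G\<^sub>r\<close>, the only conjugate of \<open>G\<^sub>r\<close> in \<open>K\<close> is \<open>G\<^sub>r\<close> itself, so the claim is that \<open>H = G\<^sub>r\<close>.

  Write \<open>\<tau> x\<close> for the element of \<open>H\<close> that maps \<open>\<one>\<close> to \<open>x\<close>. Because \<open>H\<close> is an abelian group of affine
  maps, the defect \<open>x \<star> y\<close> in \<open>\<tau> x y = x \<otimes> y \<otimes> (x \<star> y)\<close> is a commutative, associative, biadditive
  product on \<open>G\<close>: \<open>(G, \<otimes>, \<star>)\<close> is a radical ring whose circle group \<open>x \<circ> y = x \<otimes> y \<otimes> (x \<star> y)\<close> is
  isomorphic to \<open>H\<close>, hence to \<open>G\<close>. Now \<open>H = G\<^sub>r\<close> says that the product is trivial.

  The 2-closedness of \<open>K\<close> enters as rigidity. If \<open>\<phi> : G \<rightarrow> G\<close> fixes \<open>\<one>\<close> and \<open>\<phi> x / \<phi> y\<close> always lies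
  in \<open>(x / y) \<star> G\<close>, then \<open>x \<mapsto> x \<otimes> \<phi> x\<close> agrees on every pair of points with an element of \<open>K\<close>, so it
  lies in \<open>K \<le> Hol(G)\<close>, and \<open>\<phi>\<close> must be an endomorphism. The squaring map \<open>\<phi> x = x \<star> x\<close> is such a
  function (\<open>x\<^sup>2 - y\<^sup>2 = (x - y)(x + y)\<close>), and its additivity means \<open>(x \<star> y)\<^sup>2 = \<one>\<close> (lemma
  \<open>prod_sq\<close>). So only the Sylow 2-subgroup can contribute to the product.

  If that subgroup is cyclic of order 4 with generator \<open>a\<close>, then \<open>a \<star> a = a\<^sup>2\<close> would give the circle
  group two distinct involutions, while \<open>G\<close> has one (lemma \<open>prod_trivial_cyclic\<close>). If it is elementary
  abelian, then so is its circle group, which forces \<open>x \<star> x = \<one>\<close> (lemma \<open>prod_alternating\<close>), and the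
  squaring map carries no more information. Another dominated function is then used:
  \<open>\<phi> d = d \<star> x\<close> if \<open>d \<star> y \<noteq> \<one>\<close> and \<open>\<phi> d = \<one>\<close> otherwise (lemma \<open>no_dominating_pair\<close>).
  A nontrivial alternating product on a group with at most 32 involutions (the identity included)
  always has a pair \<open>(x, y)\<close> for which this \<open>\<phi>\<close> is dominated but not additive: either every \<open>x \<star> G\<close> has order at most 2, and any pair with
  \<open>x \<star> y \<noteq> \<one>\<close> works, or some \<open>x \<star> G\<close> is larger, and then the bound 32 leaves, up to a change of
  basis, a single multiplication table (locale \<open>rank_two_product\<close>).
\<close>

section \<open>Radical rings on which dominated functions are additive\<close>

text \<open>The properties of the product that a regular subgroup of a 2-closed group induces. In additive
  notation the assumption \<open>quasi_regular\<close> says that \<open>1 + y\<close> acts injectively, and \<open>rigid\<close> that a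
  function \<open>\<phi>\<close> with \<open>\<phi> x - \<phi> y \<in> (x - y)G\<close> is additive.\<close>

locale rigid_product = comm_group G for G :: "('a, 'b) monoid_scheme" (structure) +
  fixes prod :: "'a \<Rightarrow> 'a \<Rightarrow> 'a" (infixl "\<star>" 71)
  assumes fin: "finite (carrier G)"
    and prod_closed [simp]: "\<lbrakk>x \<in> carrier G; y \<in> carrier G\<rbrakk> \<Longrightarrow> x \<star> y \<in> carrier G"
    and prod_comm: "\<lbrakk>x \<in> carrier G; y \<in> carrier G\<rbrakk> \<Longrightarrow> x \<star> y = y \<star> x"
    and prod_mult: "\<lbrakk>x \<in> carrier G; y \<in> carrier G; z \<in> carrier G\<rbrakk> \<Longrightarrow>
          x \<star> (y \<otimes> z) = (x \<star> y) \<otimes> (x \<star> z)"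
    and prod_assoc: "\<lbrakk>x \<in> carrier G; y \<in> carrier G; z \<in> carrier G\<rbrakk> \<Longrightarrow>
          (x \<star> y) \<star> z = x \<star> (y \<star> z)"
    and quasi_regular: "\<lbrakk>x \<in> carrier G; y \<in> carrier G; x \<otimes> (x \<star> y) = \<one>\<rbrakk> \<Longrightarrow> x = \<one>"
    and rigid: "\<lbrakk>\<phi> \<in> carrier G \<rightarrow> carrier G; \<phi> \<one> = \<one>;
          \<And>x y. \<lbrakk>x \<in> carrier G; y \<in> carrier G\<rbrakk> \<Longrightarrow>
            \<exists>g\<in>carrier G. \<phi> x \<otimes> inv \<phi> y = (x \<otimes> inv y) \<star> g;
          a \<in> carrier G; b \<in> carrier G\<rbrakk> \<Longrightarrow> \<phi> (a \<otimes> b) = \<phi> a \<otimes> \<phi> b"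
    and circle_iso: "\<exists>h. bij_betw h (carrier G) (carrier G) \<and>
          (\<forall>x\<in>carrier G. \<forall>y\<in>carrier G. h (x \<otimes> y \<otimes> (x \<star> y)) = h x \<otimes> h y)"
begin

lemma prod_one [simp]: "x \<in> carrier G \<Longrightarrow> x \<star> \<one> = \<one>"
  using prod_mult[of x \<one> \<one>] by simp

lemma one_prod [simp]: "x \<in> carrier G \<Longrightarrow> \<one> \<star> x = \<one>"
  using prod_comm[of \<one> x] by simp

lemma mult_prod:
  "\<lbrakk>x \<in> carrier G; y \<in> carrier G; z \<in> carrier G\<rbrakk> \<Longrightarrow>
     (x \<otimes> y) \<star> z = (x \<star> z) \<otimes> (y \<star> z)"
  using prod_mult[of z x y] by (simp add: prod_comm)

lemma prod_inv: "\<lbrakk>x \<in> carrier G; y \<in> carrier G\<rbrakk> \<Longrightarrow> x \<star> inv y = inv (x \<star> y)"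
  using prod_mult[of x "inv y" y] by (intro inv_equality[symmetric]) auto

lemma inv_prod: "\<lbrakk>x \<in> carrier G; y \<in> carrier G\<rbrakk> \<Longrightarrow> inv x \<star> y = inv (x \<star> y)"
  using prod_inv[of y x] by (simp add: prod_comm)

lemma prod_pow:
  "\<lbrakk>x \<in> carrier G; y \<in> carrier G\<rbrakk> \<Longrightarrow> x \<star> (y [^] (n::nat)) = (x \<star> y) [^] n"
  by (induction n) (simp_all add: prod_mult)

lemma pow_prod:
  "\<lbrakk>x \<in> carrier G; y \<in> carrier G\<rbrakk> \<Longrightarrow> x [^] (n::nat) \<star> y = (x \<star> y) [^] n"
  using prod_pow[of y x n] by (simp add: prod_comm)

text \<open>The squaring map is dominated, as \<open>x\<^sup>2 - y\<^sup>2 = (x - y)(x + y)\<close>; its additivity is \<open>2xy = 0\<close>.\<close>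

lemma prod_sq:
  assumes x: "x \<in> carrier G" and y: "y \<in> carrier G"
  shows "(x \<star> y) \<otimes> (x \<star> y) = \<one>"
proof -
  have "\<exists>g\<in>carrier G. (a \<star> a) \<otimes> inv (b \<star> b) = (a \<otimes> inv b) \<star> g"
    if "a \<in> carrier G" "b \<in> carrier G" for a b
  proof -
    have "(a \<otimes> inv b) \<star> (a \<otimes> b) = (a \<star> a) \<otimes> ((a \<star> b) \<otimes> inv (a \<star> b)) \<otimes> inv (b \<star> b)"
      using that by (simp add: mult_prod prod_mult inv_prod prod_comm[of b a] m_ac del: r_inv l_inv Units_r_inv Units_l_inv)
    thus ?thesis using that by (intro bexI[of _ "a \<otimes> b"]) simp_all
  qed
  hence hom: "(x \<otimes> y) \<star> (x \<otimes> y) = (x \<star> x) \<otimes> (y \<star> y)"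
    using x y by (intro rigid[of "\<lambda>x. x \<star> x"]) auto
  have "(x \<otimes> y) \<star> (x \<otimes> y) = (x \<star> x) \<otimes> (y \<star> y) \<otimes> ((x \<star> y) \<otimes> (x \<star> y))"
    using x y by (simp add: mult_prod prod_mult prod_comm[of y x] m_ac)
  thus ?thesis
    using x y unfolding hom by simp
qed

lemma pow_elementary:
  assumes "x \<in> carrier G" "x \<otimes> x = \<one>"
  shows "x [^] (n::nat) = (if even n then \<one> else x)"
  using assms by (induction n) auto

lemma prod_pow_odd:
  assumes "odd (m::nat)" "x \<in> carrier G" "y \<in> carrier G"
  shows "x \<star> y [^] m = x \<star> y" "x [^] m \<star> y = x \<star> y"
  using assms by (simp_all add: prod_pow pow_prod pow_elementary prod_sq)

section \<open>The two shapes of the Sylow 2-subgroup\<close>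

text \<open>Here \<open>a\<close> generates a cyclic Sylow 2-subgroup of order 4, into which the \<open>m\<close>-th powers fall; passing
  to \<open>m\<close>-th powers does not change a product. As \<open>(a \<star> a)\<^sup>2 = \<one>\<close>, the only nontrivial value of
  \<open>a \<star> a\<close> would be \<open>a\<^sup>2\<close>; but then \<open>a \<circ> a = a\<^sup>4 = \<one>\<close> and \<open>a\<^sup>2 \<circ> a\<^sup>2 = \<one>\<close>, two involutions in the circle
  group.\<close>

lemma prod_trivial_cyclic:
  fixes m :: nat
  assumes m: "odd m" and a: "a \<in> carrier G" "a \<otimes> a \<noteq> \<one>" "a [^] (4::nat) = \<one>"
    and P: "\<And>g. g \<in> carrier G \<Longrightarrow> \<exists>i::nat. g [^] m = a [^] i"
    and xy: "x \<in> carrier G" "y \<in> carrier G"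
  shows "x \<star> y = \<one>"
proof -
  have a4: "a \<otimes> a \<otimes> (a \<otimes> a) = \<one>"
    using a by (simp add: numeral_eq_Suc m_assoc)
  have inv_G: "g = \<one> \<or> g = a \<otimes> a" if g: "g \<in> carrier G" "g \<otimes> g = \<one>" for g
  proof -
    obtain i :: nat where i: "g = a [^] i"
      using P[OF g(1)] pow_elementary[OF g] m by auto
    have "(a \<otimes> a) [^] i = \<one>"
      using g(2) a(1) by (simp add: i pow_mult_distrib m_comm)
    hence "even i"
      using a a4 by (auto simp: pow_elementary split: if_splits)
    then obtain j where "i = j * 2" by (metis dvd_mult_div_cancel mult.commute)
    hence "g = (a \<otimes> a) [^] j"
      using a(1) by (simp add: i pow_mult_distrib nat_pow_mult mult_2_right)
    thus ?thesis using a a4 by (simp add: pow_elementary)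
  qed
  obtain h where h: "bij_betw h (carrier G) (carrier G)"
    "\<And>x y. x\<in>carrier G \<Longrightarrow> y\<in>carrier G \<Longrightarrow> h (x \<otimes> y \<otimes> (x \<star> y)) = h x \<otimes> h y"
    using circle_iso by blast
  have h1: "h \<one> = \<one>"
    using h(2)[of \<one> \<one>] bij_betwE[OF h(1)] by simp
  have hc: "h x \<in> carrier G" if "x \<in> carrier G" for x using h(1) that by (auto dest: bij_betwE)
  have hi: "h x = h y \<Longrightarrow> x = y" if "x \<in> carrier G" "y \<in> carrier G" for x y
    using h(1) that by (auto dest: bij_betw_imp_inj_on inj_onD)
  have "a \<star> a = \<one>"
  proof (rule ccontr)
    assume n: "a \<star> a \<noteq> \<one>"
    hence aa: "a \<star> a = a \<otimes> a"
      using inv_G[of "a \<star> a"] a(1) prod_sq by auto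
    have "h a \<otimes> h a = \<one>"
      using h(2)[OF a(1) a(1)] a4 h1 by (simp add: aa)
    moreover have "(a \<otimes> a) \<star> (a \<otimes> a) = \<one>"
      using a(1) by (simp add: mult_prod prod_mult prod_sq)
    hence "h (a \<otimes> a) \<otimes> h (a \<otimes> a) = \<one>"
      using h(2)[of "a \<otimes> a" "a \<otimes> a"] a4 h1 a(1) by simp
    ultimately have "h a = \<one> \<or> h (a \<otimes> a) = \<one> \<or> h a = h (a \<otimes> a)"
      using inv_G hc a(1) by (metis m_closed)
    hence "a = \<one> \<or> a \<otimes> a = \<one> \<or> a = a \<otimes> a"
      using hi h1 a(1) by (metis m_closed one_closed)
    thus False using a by auto
  qed
  moreover obtain i j :: nat where "x [^] m = a [^] i" "y [^] m = a [^] j"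
    using P xy by blast
  moreover have "x \<star> y = x [^] m \<star> y [^] m"
    using prod_pow_odd m xy by simp
  ultimately show ?thesis
    using a(1) by (simp add: prod_pow pow_prod)
qed

text \<open>The \<open>n\<close>-th circle power of \<open>x\<close> is, additively, \<open>(1 + x)\<^sup>n - 1 = nx + xs\<close> with a suitable \<open>s\<close>.\<close>

lemma circle_pow:
  fixes n :: nat
  assumes h: "bij_betw h (carrier G) (carrier G)"
    "\<And>x y. x\<in>carrier G \<Longrightarrow> y\<in>carrier G \<Longrightarrow> h (x \<otimes> y \<otimes> (x \<star> y)) = h x \<otimes> h y"
    and x: "x \<in> carrier G"
  shows "\<exists>s\<in>carrier G. h x [^] n = h (x [^] n \<otimes> (x \<star> s))"
proof (induction n)
  case 0
  have "h \<one> = \<one>"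
    using h(2)[of \<one> \<one>] bij_betwE[OF h(1)] by simp
  thus ?case using x by (intro bexI[of _ \<one>]) auto
next
  case (Suc n)
  then obtain s where s: "s \<in> carrier G" "h x [^] n = h (x [^] n \<otimes> (x \<star> s))" by blast
  let ?c = "x [^] n \<otimes> (x \<star> s)"
  have "h x [^] Suc n = h (?c \<otimes> x \<otimes> (?c \<star> x))"
    using s x h(2) by simp
  also have "?c \<otimes> x \<otimes> (?c \<star> x) = x [^] Suc n \<otimes> (x \<star> (s \<otimes> ?c))"
    using s x prod_comm[of ?c x] by (simp add: prod_mult m_ac)
  finally show ?case using s x by (intro bexI[of _ "s \<otimes> ?c"]) auto
qed

text \<open>Let \<open>p = x\<^sup>m\<close>, so that \<open>p\<^sup>2 = \<one>\<close> and the circle square of \<open>p\<close> is \<open>c = p \<star> p\<close>. The circle group has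
  exponent dividing \<open>2m\<close> like \<open>G\<close>, so the \<open>m\<close>-th circle power of \<open>c\<close> vanishes. As \<open>m\<close> is odd and
  \<open>c\<^sup>2 = \<one>\<close>, that power is \<open>c \<otimes> (c \<star> s)\<close>, and quasi-regularity gives \<open>c = \<one>\<close>.\<close>

lemma prod_alternating:
  fixes m :: nat
  assumes m: "odd m" and exp: "\<And>g. g \<in> carrier G \<Longrightarrow> g [^] (2 * m) = \<one>"
    and x: "x \<in> carrier G"
  shows "x \<star> x = \<one>"
proof -
  obtain h where h: "bij_betw h (carrier G) (carrier G)"
    "\<And>x y. x\<in>carrier G \<Longrightarrow> y\<in>carrier G \<Longrightarrow> h (x \<otimes> y \<otimes> (x \<star> y)) = h x \<otimes> h y"
    using circle_iso by blast
  have h1: "h \<one> = \<one>"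
    using h(2)[of \<one> \<one>] bij_betwE[OF h(1)] by simp
  have hc: "h x \<in> carrier G" if "x \<in> carrier G" for x using h(1) that by (auto dest: bij_betwE)
  define p where "p = x [^] m"
  define c where "c = p \<star> p"
  have p: "p \<in> carrier G" "p \<otimes> p = \<one>"
    using x exp[OF x] by (simp_all add: p_def nat_pow_mult mult_2)
  have c: "c \<in> carrier G" "c \<otimes> c = \<one>"
    using p by (simp_all add: c_def prod_sq)
  obtain s where s: "s \<in> carrier G" "h c [^] m = h (c [^] m \<otimes> (c \<star> s))"
    using circle_pow[OF h c(1)] by blast
  have "h c = h p [^] (2::nat)"
    using h(2)[OF p(1) p(1)] p c hc by (simp add: c_def numeral_eq_Suc)
  hence "h c [^] m = \<one>"
    using exp[of "h p"] hc[OF p(1)] by (simp add: nat_pow_pow)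
  hence "h (c \<otimes> (c \<star> s)) = h \<one>"
    using s h1 pow_elementary[OF c] m by simp
  hence "c \<otimes> (c \<star> s) = \<one>"
    using h(1) c s by (auto dest!: bij_betw_imp_inj_on inj_onD)
  hence "c = \<one>" using quasi_regular c s by blast
  thus ?thesis using prod_pow_odd m x by (simp add: c_def p_def)
qed

text \<open>The function \<open>\<phi> d = d \<star> x\<close> off the annihilator \<open>L\<close> of \<open>y\<close>, and \<open>\<phi> d = \<one>\<close> on \<open>L\<close>, fails to be additive
  at \<open>x \<otimes> y\<close>. It is dominated: only the case of one argument \<open>p\<close> outside and the other, \<open>q\<close>, inside \<open>L\<close>
  is in question. With \<open>d = p / q\<close>, which lies outside \<open>L\<close>, additively \<open>px = dx + qx\<close>, and \<open>dom\<close> puts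
  \<open>qx\<close> into \<open>dG\<close>.\<close>

lemma no_dominating_pair:
  assumes x: "x \<in> carrier G" and y: "y \<in> carrier G" and xx: "x \<star> x = \<one>" and yy: "y \<star> y = \<one>"
    and xy: "x \<star> y \<noteq> \<one>"
    and dom: "\<And>d l. \<lbrakk>d \<in> carrier G; l \<in> carrier G; d \<star> y \<noteq> \<one>; l \<star> y = \<one>\<rbrakk> \<Longrightarrow>
            \<exists>g\<in>carrier G. l \<star> x = d \<star> g"
  shows False
proof -
  define \<phi> where "\<phi> d = (if d \<star> y = \<one> then \<one> else d \<star> x)" for d
  have inv_el: "inv (a \<star> b) = a \<star> b" if "a \<in> carrier G" "b \<in> carrier G" for a b
    using prod_sq that by (intro inv_equality) auto
  have "\<exists>g\<in>carrier G. \<phi> p \<otimes> inv \<phi> q = (p \<otimes> inv q) \<star> g"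
    if p: "p \<in> carrier G" and q: "q \<in> carrier G" for p q
  proof -
    let ?d = "p \<otimes> inv q"
    have d: "?d \<in> carrier G" using p q by simp
    have dy: "?d \<star> z = (p \<star> z) \<otimes> (q \<star> z)" if "z \<in> carrier G" for z
      using p q that by (simp add: mult_prod inv_prod inv_el)
    consider (oo) "p \<star> y = \<one>" "q \<star> y = \<one>" | (nn) "p \<star> y \<noteq> \<one>" "q \<star> y \<noteq> \<one>"
      | (no) "p \<star> y \<noteq> \<one>" "q \<star> y = \<one>" | (on) "p \<star> y = \<one>" "q \<star> y \<noteq> \<one>" by blast
    thus ?thesis
    proof cases
      case oo
      thus ?thesis using d by (intro bexI[of _ \<one>]) (auto simp: \<phi>_def)
    next
      case nn
      thus ?thesis using p q x dy by (intro bexI[of _ x]) (auto simp: \<phi>_def inv_el)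
    next
      case no
      hence "?d \<star> y \<noteq> \<one>" using dy[OF y] p y by simp
      then obtain g where g: "g \<in> carrier G" "q \<star> x = ?d \<star> g"
        using dom[OF d q] no by blast
      have "p \<star> x = (p \<star> x) \<otimes> (q \<star> x) \<otimes> (q \<star> x)"
        using p q x by (simp add: m_assoc prod_sq)
      also have "\<dots> = ?d \<star> (x \<otimes> g)"
        using g d x by (simp add: prod_mult dy)
      finally show ?thesis using no g x p d
        by (intro bexI[of _ "x \<otimes> g"]) (auto simp: \<phi>_def r_one)
    next
      case on
      hence "?d \<star> y \<noteq> \<one>" using dy[OF y] q y by simp
      then obtain g where g: "g \<in> carrier G" "p \<star> x = ?d \<star> g"
        using dom[OF d p] on by blast
      have "q \<star> x = (p \<star> x) \<otimes> (q \<star> x) \<otimes> (p \<star> x)"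
        using p q x by (simp add: m_ac prod_sq flip: m_assoc)
      also have "\<dots> = ?d \<star> (x \<otimes> g)"
        using g d x by (simp add: prod_mult dy)
      finally show ?thesis using on g x q d
        by (intro bexI[of _ "x \<otimes> g"]) (auto simp: \<phi>_def inv_el)
    qed
  qed
  moreover have "\<phi> \<in> carrier G \<rightarrow> carrier G" using x by (auto simp: \<phi>_def)
  moreover have "\<phi> \<one> = \<one>" using y by (simp add: \<phi>_def)
  ultimately have "\<phi> (x \<otimes> y) = \<phi> x \<otimes> \<phi> y" using x y by (intro rigid) auto
  moreover have "\<phi> (x \<otimes> y) = x \<star> y"
    using x y xx yy xy by (simp add: \<phi>_def mult_prod prod_comm[of y x])
  ultimately show False using xx yy xy by (simp add: \<phi>_def)
qed

end

section \<open>Alternating products on at most 32 involutions\<close>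

locale small_alternating_product = rigid_product +
  fixes m :: nat
  assumes odd_m: "odd m"
    and alternating: "x \<in> carrier G \<Longrightarrow> x \<star> x = \<one>"
    and pow_m: "x \<in> carrier G \<Longrightarrow> x [^] m \<otimes> x [^] m = \<one>"
    and small: "card {x \<in> carrier G. x \<otimes> x = \<one>} \<le> 32"
begin

text \<open>The identity is included, so that the involutions are the elements of a subgroup.\<close>

definition involution :: "'a \<Rightarrow> bool" where
  "involution x \<longleftrightarrow> x \<in> carrier G \<and> x \<otimes> x = \<one>"

lemma involutionD [dest]: "involution x \<Longrightarrow> x \<in> carrier G"
  by (simp add: involution_def)

lemma involution_pow: "involution x \<Longrightarrow> x [^] (n::nat) = (if even n then \<one> else x)"
  by (simp add: involution_def pow_elementary)

lemma involution_prod: "\<lbrakk>x \<in> carrier G; y \<in> carrier G\<rbrakk> \<Longrightarrow> involution (x \<star> y)"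
  by (simp add: involution_def prod_sq)

lemma involution_mult:
  assumes "involution x" "involution y" shows "involution (x \<otimes> y)"
proof -
  have "(x \<otimes> y) \<otimes> (x \<otimes> y) = (x \<otimes> x) \<otimes> (y \<otimes> y)"
    using assms by (simp add: involution_def m_ac del: r_one l_one)
  thus ?thesis using assms by (simp add: involution_def)
qed

lemma involution_mult_eq_one_iff:
  assumes "involution x" "involution y" shows "x \<otimes> y = \<one> \<longleftrightarrow> x = y"
proof
  assume "x \<otimes> y = \<one>"
  hence "x \<otimes> y = y \<otimes> y" using assms by (simp add: involution_def)
  thus "x = y" by (metis assms involutionD right_cancel)
qed (use assms in \<open>simp add: involution_def\<close>)

lemma involution_nat_pow: "involution x \<Longrightarrow> involution (x [^] (n::nat))"
  by (auto simp: involution_pow) (simp add: involution_def)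

lemma prod_left_self: "\<lbrakk>x \<in> carrier G; y \<in> carrier G\<rbrakk> \<Longrightarrow> x \<star> (x \<star> y) = \<one>"
  using prod_assoc[of x x y] by (simp add: alternating)

text \<open>The general element of the span of \<open>x\<close>, \<open>y\<close>, \<open>z\<close>, \<open>x \<star> y\<close> and \<open>x \<star> z\<close>. Natural number exponents, rather
  than exponents modulo 2, keep \<open>word_mult\<close> free of case distinctions.\<close>

definition word :: "'a \<Rightarrow> 'a \<Rightarrow> 'a \<Rightarrow> nat \<Rightarrow> nat \<Rightarrow> nat \<Rightarrow> nat \<Rightarrow> nat \<Rightarrow> 'a" where
  "word x y z a b c i j =
     x [^] a \<otimes> y [^] b \<otimes> z [^] c \<otimes> (x \<star> y) [^] i \<otimes> (x \<star> z) [^] j"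

lemma word_closed [simp]:
  "\<lbrakk>x \<in> carrier G; y \<in> carrier G; z \<in> carrier G\<rbrakk> \<Longrightarrow> word x y z a b c i j \<in> carrier G"
  by (simp add: word_def)

lemma word_involution:
  "\<lbrakk>involution x; involution y; involution z\<rbrakk> \<Longrightarrow> involution (word x y z a b c i j)"
  unfolding word_def by (intro involution_mult involution_nat_pow involution_prod) auto

lemma word_mult:
  "\<lbrakk>x \<in> carrier G; y \<in> carrier G; z \<in> carrier G\<rbrakk> \<Longrightarrow>
     word x y z a b c i j \<otimes> word x y z a' b' c' i' j' =
     word x y z (a + a') (b + b') (c + c') (i + i') (j + j')"
  by (simp add: word_def m_ac flip: nat_pow_mult)

lemma prod_word:
  assumes "w \<in> carrier G" "x \<in> carrier G" "y \<in> carrier G" "z \<in> carrier G"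
  shows "w \<star> word x y z a b c i j =
     (w \<star> x) [^] a \<otimes> (w \<star> y) [^] b \<otimes> (w \<star> z) [^] c \<otimes> (w \<star> (x \<star> y)) [^] i \<otimes> (w \<star> (x \<star> z)) [^] j"
  using assms by (simp add: word_def prod_mult prod_pow)

end

text \<open>The case in which \<open>x \<star> G\<close> has more than two elements. The five elements \<open>x\<close>, \<open>y\<close>, \<open>z\<close>, \<open>x \<star> y\<close>,
  \<open>x \<star> z\<close> are then independent, so that they form a basis of the at most 32 involutions.\<close>

locale rank_two_product = small_alternating_product +
  fixes x y z
  assumes x: "involution x" and y: "involution y" and z: "involution z"
    and xy: "x \<star> y \<noteq> \<one>" and xz: "x \<star> z \<noteq> \<one>" and xy_xz: "x \<star> y \<noteq> x \<star> z"
begin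

lemma closed [simp]: "x \<in> carrier G" "y \<in> carrier G" "z \<in> carrier G"
  using x y z by auto

lemma xy_xz_independent:
  assumes "(x \<star> y) [^] (b::nat) \<otimes> (x \<star> z) [^] (c::nat) = \<one>"
  shows "even b \<and> even c"
  using assms xy xz xy_xz
  by (auto simp: involution_pow involution_prod involution_mult_eq_one_iff split: if_splits)

text \<open>Multiplying by \<open>x\<close> kills all but the exponents of \<open>y\<close> and \<open>z\<close>, which are therefore even. If the exponent
  of \<open>x\<close> were odd, the rest of the relation would read \<open>x \<otimes> (x \<star> g) = \<one>\<close>, contrary to
  quasi-regularity.\<close>

lemma word_eq_one:
  assumes w: "word x y z a b c i j = \<one>"
  shows "even a \<and> even b \<and> even c \<and> even i \<and> even j"
proof -
  have "x \<star> word x y z a b c i j = (x \<star> y) [^] b \<otimes> (x \<star> z) [^] c"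
    by (simp add: prod_word prod_left_self alternating)
  hence bc: "even b" "even c" using w xy_xz_independent by auto
  let ?g = "y [^] i \<otimes> z [^] j"
  have w': "x [^] a \<otimes> (x \<star> ?g) = \<one>"
    using w bc by (simp add: word_def involution_pow[OF y, of b] involution_pow[OF z, of c] prod_mult prod_pow m_ac)
  have a: "even a"
  proof (rule ccontr)
    assume "odd a"
    hence "x \<otimes> (x \<star> ?g) = \<one>" using w' by (simp add: involution_pow[OF x])
    hence "x = \<one>" using quasi_regular[of x ?g] by simp
    thus False using xy by simp
  qed
  hence "(x \<star> y) [^] i \<otimes> (x \<star> z) [^] j = \<one>"
    using w' by (simp add: involution_pow[OF x] prod_mult prod_pow)
  thus ?thesis using a bc xy_xz_independent by blast
qed

lemma involution_word:
  assumes d: "involution d"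
  obtains a b c i j where "d = word x y z a b c i j"
proof -
  define W where "W = (\<lambda>(a, b, c, i, j). word x y z a b c i j)"
  define B where "B = {0, 1::nat}"
  define T where "T = B \<times> B \<times> B \<times> B \<times> B"
  have "inj_on W T"
  proof (rule inj_onI)
    fix s t assume st: "s \<in> T" "t \<in> T" "W s = W t"
    obtain a b c i j a' b' c' i' j' where e: "s = (a, b, c, i, j)" "t = (a', b', c', i', j')"
      by (metis prod_cases5)
    have "W s \<otimes> W t = \<one>"
      using st(3) word_involution[OF x y z] by (simp add: e W_def involution_def)
    hence "even (a + a') \<and> even (b + b') \<and> even (c + c') \<and> even (i + i') \<and> even (j + j')"
      by (intro word_eq_one) (simp add: e W_def word_mult)
    moreover have "p = q" if "p \<in> B" "q \<in> B" "even (p + q)" for p q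
      using that by (auto simp: B_def)
    ultimately show "s = t" using st(1,2) by (simp add: e T_def)
  qed
  hence "card (W ` T) = 32" by (simp add: card_image T_def B_def card_cartesian_product)
  moreover have "W ` T \<subseteq> {d \<in> carrier G. d \<otimes> d = \<one>}"
    using word_involution[OF x y z] by (auto simp: W_def involution_def)
  ultimately have "W ` T = {d \<in> carrier G. d \<otimes> d = \<one>}"
    using small fin by (intro card_seteq) auto
  hence "d \<in> W ` T" using d by (auto simp: involution_def)
  thus thesis using that by (auto simp: W_def)
qed

lemma y_xz: "y \<star> (x \<star> z) = (x \<star> y) \<star> z"
  by (metis closed prod_assoc prod_comm)

text \<open>The triple product \<open>t\<close> is annihilated by \<open>x\<close>, \<open>y\<close> and \<open>z\<close>. Comparing this with the coordinates of
  \<open>t\<close> forces \<open>x \<star> y = t = x \<star> z\<close> unless \<open>t = \<one>\<close>.\<close>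

lemma xyz_trivial: "(x \<star> y) \<star> z = \<one>"
proof (rule ccontr)
  define t where "t = (x \<star> y) \<star> z"
  assume "(x \<star> y) \<star> z \<noteq> \<one>"
  hence t1: "t \<noteq> \<one>" by (simp add: t_def)
  have t: "involution t" by (simp add: t_def involution_prod)
  have yxy: "y \<star> (x \<star> y) = \<one>" using prod_left_self[of y x] by (simp add: prod_comm)
  have zxz: "z \<star> (x \<star> z) = \<one>" using prod_left_self[of z x] by (simp add: prod_comm)
  have zxy: "z \<star> (x \<star> y) = t" by (simp add: t_def prod_comm)
  have yxz: "y \<star> (x \<star> z) = t" by (simp add: t_def y_xz)
  have xt: "x \<star> t = \<one>" unfolding t_def by (simp add: prod_assoc prod_left_self)
  have zt: "z \<star> t = \<one>" unfolding zxy[symmetric] by (simp add: prod_left_self)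
  have yt: "y \<star> t = \<one>" unfolding yxz[symmetric] by (simp add: prod_left_self)
  obtain a b c i j where w: "t = word x y z a b c i j" using involution_word[OF t] .
  have "(x \<star> y) [^] b \<otimes> (x \<star> z) [^] c = \<one>"
    using xt unfolding w by (simp add: prod_word prod_left_self alternating)
  hence bc: "even b" "even c" using xy_xz_independent by blast+
  have 1: "(x \<star> y) [^] a \<otimes> t [^] j = \<one>"
    using yt prod_word[of y x y z a b c i j, folded w] t involutionD[OF t] bc
    by (simp add: yxy yxz involution_pow involution_prod alternating prod_comm[of y x])
  have 2: "(x \<star> z) [^] a \<otimes> t [^] i = \<one>"
    using zt prod_word[of z x y z a b c i j, folded w] t involutionD[OF t] bc
    by (simp add: zxz zxy involution_pow involution_prod alternating prod_comm[of z x])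
  have "x \<star> y = t \<and> x \<star> z = t \<or> even a \<and> even i \<and> even j"
    using 1 2 t t1 xy xz
    by (auto simp: involution_pow involution_prod involution_mult_eq_one_iff split: if_splits)
  hence "even a \<and> even i \<and> even j" using xy_xz by auto
  hence "t = \<one>" unfolding w word_def using bc x y z by (simp add: involution_pow involution_prod)
  thus False using t1 by simp
qed

text \<open>The product \<open>y \<star> z\<close> is annihilated by \<open>x\<close> and by \<open>y\<close>, which excludes the other basis elements.\<close>

lemma yz_in_span: obtains i j :: nat where "y \<star> z = (x \<star> y) [^] i \<otimes> (x \<star> z) [^] j"
proof -
  have q: "involution (y \<star> z)" by (simp add: involution_prod)
  obtain a b c i j where w: "y \<star> z = word x y z a b c i j" using involution_word[OF q] .
  have "x \<star> (y \<star> z) = \<one>" using xyz_trivial by (simp add: prod_assoc)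
  hence "(x \<star> y) [^] b \<otimes> (x \<star> z) [^] c = \<one>"
    unfolding w by (simp add: prod_word prod_left_self alternating)
  hence bc: "even b" "even c" using xy_xz_independent by blast+
  have "y \<star> (x \<star> z) = \<one>"
    using xyz_trivial y_xz by simp
  moreover have "y \<star> (x \<star> y) = \<one>" using prod_left_self[of y x] by (simp add: prod_comm)
  moreover have "y \<star> word x y z a b c i j = \<one>"
    unfolding w[symmetric] by (simp add: prod_left_self)
  ultimately have "(x \<star> y) [^] a = \<one>"
    using bc by (simp add: prod_word alternating involution_pow involution_prod prod_comm[of y x])
  hence "even a" using xy by (simp add: involution_pow involution_prod split: if_splits)
  thus thesis using that[of i j] w bc x y z
    by (simp add: word_def involution_pow)
qed

text \<open>If \<open>y \<star> z = \<one>\<close>, the multiplication table is complete: an element \<open>d\<close> with exponent \<open>a\<close> at \<open>x\<close> has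
  \<open>d \<star> y = (x \<star> y)\<^sup>a\<close> and \<open>d \<star> z = (x \<star> z)\<^sup>a\<close>. So for \<open>d\<close>
  outside the annihilator of \<open>y\<close>, \<open>d \<star> G\<close> contains both \<open>x \<star> y\<close> and \<open>x \<star> z\<close>, hence all of \<open>x \<star> G\<close>.\<close>

lemma yz_nontrivial: "y \<star> z \<noteq> \<one>"
proof
  assume yz: "y \<star> z = \<one>"
  have zy: "z \<star> y = \<one>" using yz by (simp add: prod_comm)
  have yxy: "y \<star> (x \<star> y) = \<one>" using prod_left_self[of y x] by (simp add: prod_comm)
  have zxz: "z \<star> (x \<star> z) = \<one>" using prod_left_self[of z x] by (simp add: prod_comm)
  have zxy: "z \<star> (x \<star> y) = \<one>" using xyz_trivial by (simp add: prod_comm)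
  have yxz: "y \<star> (x \<star> z) = \<one>"
    using xyz_trivial y_xz by simp
  have coords: "\<exists>(a::nat) (b::nat) (c::nat). x \<star> d = (x \<star> y) [^] b \<otimes> (x \<star> z) [^] c \<and>
      y \<star> d = (x \<star> y) [^] a \<and> z \<star> d = (x \<star> z) [^] a" if d: "d \<in> carrier G" for d
  proof -
    have "involution (d [^] m)" using d pow_m by (simp add: involution_def)
    then obtain a b c i j where w: "d [^] m = word x y z a b c i j" by (rule involution_word)
    have g: "g \<star> d = g \<star> word x y z a b c i j" if "g \<in> carrier G" for g
      using prod_pow_odd(1)[OF odd_m that d] by (simp add: w)
    have "x \<star> d = (x \<star> y) [^] b \<otimes> (x \<star> z) [^] c"
      by (simp add: g prod_word prod_left_self alternating)
    moreover have "y \<star> d = (x \<star> y) [^] a"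
      by (simp add: g prod_word alternating yz yxy yxz prod_comm[of y x])
    moreover have "z \<star> d = (x \<star> z) [^] a"
      by (simp add: g prod_word alternating zy zxz zxy prod_comm[of z x])
    ultimately show ?thesis by blast
  qed
  show False
  proof (rule no_dominating_pair[of x y])
    fix d l assume d: "d \<in> carrier G" and l: "l \<in> carrier G" and dy: "d \<star> y \<noteq> \<one>" and ly: "l \<star> y = \<one>"
    obtain b c :: nat where bc: "x \<star> l = (x \<star> y) [^] b \<otimes> (x \<star> z) [^] c"
      using coords[OF l] by blast
    obtain a :: nat where a: "y \<star> d = (x \<star> y) [^] a" "z \<star> d = (x \<star> z) [^] a"
      using coords[OF d] by blast
    have "odd a" using a dy d prod_comm[of d y] by (auto simp: involution_pow involution_prod)
    hence "d \<star> y = x \<star> y" "d \<star> z = x \<star> z"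
      using a d prod_comm[of d y] prod_comm[of d z] by (simp_all add: involution_pow involution_prod)
    hence "l \<star> x = d \<star> (y [^] b \<otimes> z [^] c)"
      using bc d l prod_comm[of l x] by (simp add: prod_mult prod_pow)
    thus "\<exists>g\<in>carrier G. l \<star> x = d \<star> g" by (intro bexI[of _ "y [^] b \<otimes> z [^] c"]) simp_all
  qed (use xy in \<open>simp_all add: alternating\<close>)
qed

end

context small_alternating_product
begin

text \<open>Replacing \<open>y\<close> by \<open>y \<otimes> x\<^sup>j\<close> and \<open>z\<close> by \<open>z \<otimes> x\<^sup>i\<close> changes neither \<open>x \<star> y\<close> nor \<open>x \<star> z\<close>, but multiplies
  \<open>y \<star> z = (x \<star> y)\<^sup>i \<otimes> (x \<star> z)\<^sup>j\<close> by itself, and so makes it trivial.\<close>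

lemma no_rank_two_involutions:
  assumes x: "involution x" and y: "involution y" and z: "involution z"
    and ne: "x \<star> y \<noteq> \<one>" "x \<star> z \<noteq> \<one>"
  shows "x \<star> y = x \<star> z"
proof (rule ccontr)
  assume "x \<star> y \<noteq> x \<star> z"
  then interpret A: rank_two_product G prod m x y z
    using ne x y z by unfold_locales
  obtain i j :: nat where ij: "y \<star> z = (x \<star> y) [^] i \<otimes> (x \<star> z) [^] j"
    by (rule A.yz_in_span)
  let ?y' = "y \<otimes> x [^] j" and ?z' = "z \<otimes> x [^] i"
  have xy': "x \<star> ?y' = x \<star> y" "x \<star> ?z' = x \<star> z"
    by (simp_all add: prod_mult prod_pow alternating)
  interpret B: rank_two_product G prod m x ?y' ?z'
    using A.xy A.xz A.xy_xz x y z
    by unfold_locales (simp_all only: xy' involution_mult involution_nat_pow not_False_eq_True)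
  have "?y' \<star> ?z' = (y \<star> z) \<otimes> ((x \<star> y) [^] i \<otimes> (x \<star> z) [^] j)"
    by (simp add: prod_mult mult_prod prod_pow pow_prod alternating prod_comm[of y x] m_ac)
  also have "\<dots> = \<one>" unfolding ij[symmetric] by (simp add: prod_sq)
  finally show False using B.yz_nontrivial by simp
qed

lemma no_rank_two:
  assumes "x \<in> carrier G" "y \<in> carrier G" "z \<in> carrier G" "x \<star> y \<noteq> \<one>" "x \<star> z \<noteq> \<one>"
  shows "x \<star> y = x \<star> z"
  using no_rank_two_involutions[of "x [^] m" "y [^] m" "z [^] m"] assms odd_m pow_m
  by (simp add: prod_pow_odd involution_def)

text \<open>By \<open>no_rank_two\<close> the nontrivial products with \<open>u\<close> all have the same value \<open>u \<star> v\<close>, and so do those with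
  \<open>v\<close>; this makes \<open>(v, u)\<close> a dominating pair.\<close>

lemma trivial:
  assumes u: "u \<in> carrier G" and v: "v \<in> carrier G"
  shows "u \<star> v = \<one>"
proof (rule ccontr)
  assume uv: "u \<star> v \<noteq> \<one>"
  have u': "d \<star> u = v \<star> u" if "d \<in> carrier G" "d \<star> u \<noteq> \<one>" for d
    using no_rank_two[of u d v] that u v uv by (simp add: prod_comm)
  have v': "d \<star> v = u \<star> v" if "d \<in> carrier G" "d \<star> v \<noteq> \<one>" for d
    using no_rank_two[of v d u] that u v uv by (simp add: prod_comm)
  show False
  proof (rule no_dominating_pair[of v u])
    fix d l assume d: "d \<in> carrier G" and l: "l \<in> carrier G" and "d \<star> u \<noteq> \<one>" "l \<star> u = \<one>"
    hence du: "d \<star> u = u \<star> v" using u' u v by (simp add: prod_comm)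
    show "\<exists>g\<in>carrier G. l \<star> v = d \<star> g"
    proof (cases "l \<star> v = \<one>")
      case True
      thus ?thesis using d by (intro bexI[of _ \<one>]) auto
    next
      case False
      thus ?thesis using v'[OF l] du u by (intro bexI[of _ u]) auto
    qed
  qed (use u v uv prod_comm[of v u] in \<open>simp_all add: alternating\<close>)
qed

end

section \<open>Powers in the Sylow 2-subgroup\<close>

lemma (in comm_group) sylow_two:
  assumes fin: "finite (carrier G)"
  obtains P m where "sylow_subgroup 2 P G" "odd (m::nat)" "\<And>g. g \<in> carrier G \<Longrightarrow> g [^] m \<in> P"
proof -
  define a where "a = multiplicity (2::nat) (order G)"
  define m where "m = order G div 2 ^ a"
  have ne: "order G \<noteq> 0" using fin order_gt_0_iff_finite by auto
  have ord: "order G = 2 ^ a * m" by (simp add: a_def m_def multiplicity_dvd)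
  have m: "odd m"
    unfolding m_def a_def by (rule multiplicity_decompose) (use ne in auto)
  obtain P where P: "subgroup P G" "card P = 2 ^ a"
    using sylow_thm[OF two_is_prime_nat group_axioms ord fin] by blast
  interpret N: normal P G using P(1) by (rule subgroup_imp_normal)
  interpret Q: group "G Mod P" by (rule N.factorgroup_is_group)
  interpret \<pi>: group_hom G "G Mod P" "\<lambda>g. P #> g"
    using N.r_coset_hom_Mod by unfold_locales
  have "order (G Mod P) * card P = order G"
    using lagrange[OF P(1)] by (simp add: order_def FactGroup_def)
  hence ordQ: "order (G Mod P) = m" using P(2) ord by simp
  have "g [^] m \<in> P" if g: "g \<in> carrier G" for g
  proof -
    have "P #> (g [^] m) = \<one>\<^bsub>G Mod P\<^esub>"
      using Q.pow_order_eq_1[of "P #> g"] g \<pi>.hom_nat_pow[OF g, of m] \<pi>.hom_closed[OF g]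
      by (simp add: ordQ)
    hence "P #> (g [^] m) = P" by simp
    thus ?thesis using g P(1) by (metis nat_pow_closed rcos_self)
  qed
  moreover have "sylow_subgroup 2 P G" using P by (simp add: sylow_subgroup_def a_def)
  ultimately show thesis using m that by blast
qed

section \<open>The radical ring of a regular subgroup of the holomorph\<close>

locale regular_in_two_closed_holomorph = comm_group G for G :: "('a, 'b) monoid_scheme" (structure) +
  fixes K H :: "('a \<Rightarrow> 'a) set"
  assumes fin: "finite (carrier G)"
    and K: "subgroup K (BijGroup (carrier G))"
    and K_closed: "two_closed (carrier G) K"
    and R_K: "right_translations G \<subseteq> K"
    and K_hol: "K \<subseteq> holomorph G"
    and H_K: "H \<subseteq> K"
    and H: "G_regular G H"
begin

abbreviation "\<Omega> \<equiv> carrier G"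

lemma K_Bij: "k \<in> K \<Longrightarrow> k \<in> Bij \<Omega>"
  using subgroup.subset[OF K] by (auto simp: BijGroup_simps)

lemma K_apply [simp]: "k \<in> K \<Longrightarrow> x \<in> \<Omega> \<Longrightarrow> k x \<in> \<Omega>"
  using K_Bij Bij_apply by metis

definition translation :: "'a \<Rightarrow> 'a \<Rightarrow> 'a" where
  "translation g = (\<lambda>x\<in>\<Omega>. x \<otimes> g)"

lemma translation_K: "g \<in> \<Omega> \<Longrightarrow> translation g \<in> K"
  using R_K by (auto simp: right_translations_def translation_def)

text \<open>Normalising the translations means \<open>k(xg) = k(x)g'\<close> with \<open>g'\<close> depending only on \<open>k\<close> and \<open>g\<close>; the value
  \<open>g' = k(g)/k(\<one>)\<close> is read off at \<open>x = \<one>\<close>.\<close>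

lemma K_affine:
  assumes k: "k \<in> K" and x: "x \<in> \<Omega>" and g: "g \<in> \<Omega>"
  shows "k (x \<otimes> g) \<otimes> k \<one> = k x \<otimes> k g"
proof -
  interpret S: group "BijGroup \<Omega>" by (rule group_BijGroup)
  let ?R = "right_translations G"
  have RB: "?R \<subseteq> carrier (BijGroup \<Omega>)"
    using R_K K_Bij by (auto simp: BijGroup_simps)
  have kB: "k \<in> carrier (BijGroup \<Omega>)" using k K_Bij by (simp add: BijGroup_simps)
  have gB: "translation g \<in> carrier (BijGroup \<Omega>)"
    using translation_K[OF g] K_Bij by (simp add: BijGroup_simps)
  have "k <#\<^bsub>BijGroup \<Omega>\<^esub> ?R #>\<^bsub>BijGroup \<Omega>\<^esub> inv\<^bsub>BijGroup \<Omega>\<^esub> k = ?R"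
    using k K_hol RB by (auto simp: holomorph_def normalizer_def stabilizer_def)
  moreover have "translation g \<in> ?R"
    using g by (auto simp: right_translations_def translation_def)
  ultimately have "k \<otimes>\<^bsub>BijGroup \<Omega>\<^esub> translation g \<otimes>\<^bsub>BijGroup \<Omega>\<^esub> inv\<^bsub>BijGroup \<Omega>\<^esub> k \<in> ?R"
    by (auto simp: l_coset_def r_coset_def)
  then obtain g' where g': "g' \<in> \<Omega>"
    "k \<otimes>\<^bsub>BijGroup \<Omega>\<^esub> translation g \<otimes>\<^bsub>BijGroup \<Omega>\<^esub> inv\<^bsub>BijGroup \<Omega>\<^esub> k = translation g'"
    by (auto simp: right_translations_def translation_def)
  have g'B: "translation g' \<in> carrier (BijGroup \<Omega>)"
    using translation_K[OF g'(1)] K_Bij by (simp add: BijGroup_simps)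
  have "k \<otimes>\<^bsub>BijGroup \<Omega>\<^esub> translation g = translation g' \<otimes>\<^bsub>BijGroup \<Omega>\<^esub> k"
    using g'(2) kB gB g'B by (metis S.inv_solve_right' S.m_closed)
  hence eq: "compose \<Omega> k (translation g) = compose \<Omega> (translation g') k"
    using kB gB g'B by (simp add: BijGroup_simps)
  have shift: "k (y \<otimes> g) = k y \<otimes> g'" if "y \<in> \<Omega>" for y
    using fun_cong[OF eq, of y] that k by (simp add: compose_def translation_def)
  show ?thesis
    using shift[OF x] shift[of \<one>] x g k g' by (simp add: m_ac)
qed

lemma H_sub: "subgroup H (BijGroup \<Omega>)"
  using H by (simp add: G_regular_def)

lemma H_in_K [simp]: "t \<in> H \<Longrightarrow> t \<in> K"
  using H_K by blast

lemma H_transitive: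
  assumes "x \<in> \<Omega>" shows "\<exists>t\<in>H. t \<one> = x"
proof -
  interpret A: transitive_action "BijGroup \<Omega>\<lparr>carrier := H\<rparr>" \<Omega> "\<lambda>f. f"
    using H by (simp add: G_regular_def regular_on_def)
  show ?thesis using A.unique_orbit[of \<one> x] assms by auto
qed

lemma H_semiregular:
  assumes s: "s \<in> H" and t: "t \<in> H" and eq: "s \<one> = t \<one>"
  shows "s = t"
proof -
  obtain t' where t': "t' \<in> H" "\<And>x. x \<in> \<Omega> \<Longrightarrow> t' (t x) = x" "\<And>x. x \<in> \<Omega> \<Longrightarrow> t (t' x) = x"
    using subgroup_Bij_inverse[OF H_sub t] by metis
  have "compose \<Omega> t' s \<in> stabilizer (BijGroup \<Omega>\<lparr>carrier := H\<rparr>) (\<lambda>f. f) \<one>"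
    using subgroup_Bij_compose[OF H_sub t'(1) s] t' eq by (simp add: stabilizer_def compose_def)
  hence id: "compose \<Omega> t' s = (\<lambda>x\<in>\<Omega>. x)"
    using H by (simp add: G_regular_def regular_on_def BijGroup_simps)
  show ?thesis
  proof (rule extensionalityI)
    show "s \<in> extensional \<Omega>" "t \<in> extensional \<Omega>"
      using s t K_Bij by (auto intro!: Bij_imp_extensional)
    fix x assume x: "x \<in> \<Omega>"
    have "t' (s x) = x" using fun_cong[OF id, of x] x by (simp add: compose_def)
    thus "s x = t x" using t'(3)[of "s x"] s x by simp
  qed
qed

definition \<tau> :: "'a \<Rightarrow> 'a \<Rightarrow> 'a" where
  "\<tau> x = (THE t. t \<in> H \<and> t \<one> = x)"

lemma \<tau>: assumes "x \<in> \<Omega>" shows "\<tau> x \<in> H" "\<tau> x \<one> = x"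
proof -
  have "\<exists>!t. t \<in> H \<and> t \<one> = x" using H_transitive[OF assms] H_semiregular by blast
  from theI'[OF this] show "\<tau> x \<in> H" "\<tau> x \<one> = x" by (simp_all add: \<tau>_def)
qed

lemma \<tau>_eqI: "\<lbrakk>t \<in> H; t \<one> = x; x \<in> \<Omega>\<rbrakk> \<Longrightarrow> \<tau> x = t"
  using \<tau> H_semiregular by metis

lemma \<tau>_closed [simp]: "x \<in> \<Omega> \<Longrightarrow> y \<in> \<Omega> \<Longrightarrow> \<tau> x y \<in> \<Omega>"
  using \<tau> by simp

lemma H_iso:
  obtains h where "bij_betw h H \<Omega>"
    "\<And>s t. s \<in> H \<Longrightarrow> t \<in> H \<Longrightarrow> h (compose \<Omega> s t) = h s \<otimes> h t"
proof -
  obtain h where h: "h \<in> iso (BijGroup \<Omega>\<lparr>carrier := H\<rparr>) G"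
    using H by (auto simp: G_regular_def is_iso_def)
  show thesis
  proof (rule that)
    show "bij_betw h H \<Omega>" using h by (simp add: iso_def)
    fix s t assume "s \<in> H" "t \<in> H"
    moreover from this have "s \<in> Bij \<Omega>" "t \<in> Bij \<Omega>" using K_Bij by simp_all
    ultimately show "h (compose \<Omega> s t) = h s \<otimes> h t"
      using h by (simp add: iso_def hom_def flip: BijGroup_simps(2))
  qed
qed

lemma H_commute: assumes "s \<in> H" "t \<in> H" shows "compose \<Omega> s t = compose \<Omega> t s"
proof -
  obtain h where h: "bij_betw h H \<Omega>" "\<And>s t. s \<in> H \<Longrightarrow> t \<in> H \<Longrightarrow> h (compose \<Omega> s t) = h s \<otimes> h t"
    using H_iso by metis
  have "h (compose \<Omega> s t) = h (compose \<Omega> t s)"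
    using h assms by (auto simp: m_comm bij_betwE)
  thus ?thesis
    using h(1) assms subgroup_Bij_compose[OF H_sub] by (metis bij_betw_imp_inj_on inj_onD)
qed

lemma \<tau>_\<tau>: "\<lbrakk>x \<in> \<Omega>; y \<in> \<Omega>\<rbrakk> \<Longrightarrow> \<tau> (\<tau> x y) = compose \<Omega> (\<tau> x) (\<tau> y)"
  using \<tau> by (intro \<tau>_eqI subgroup_Bij_compose[OF H_sub]) (simp_all add: compose_def)

definition prod :: "'a \<Rightarrow> 'a \<Rightarrow> 'a" where
  "prod x y = \<tau> x y \<otimes> inv (x \<otimes> y)"

lemma prod_closed: "x \<in> \<Omega> \<Longrightarrow> y \<in> \<Omega> \<Longrightarrow> prod x y \<in> \<Omega>"
  by (simp add: prod_def)

lemma \<tau>_prod: "x \<in> \<Omega> \<Longrightarrow> y \<in> \<Omega> \<Longrightarrow> \<tau> x y = x \<otimes> y \<otimes> prod x y"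
  using m_lcomm[of "x \<otimes> y" "\<tau> x y" "inv (x \<otimes> y)"] by (simp add: prod_def)

lemma prod_comm: assumes "x \<in> \<Omega>" "y \<in> \<Omega>" shows "prod x y = prod y x"
proof -
  have "\<tau> x y = \<tau> y x"
    using fun_cong[OF H_commute[OF \<tau>(1)[OF assms(1)] \<tau>(1)[OF assms(2)]], of \<one>] assms
    by (simp add: compose_def \<tau>)
  thus ?thesis using assms by (simp add: prod_def m_comm)
qed

lemma prod_mult:
  assumes "x \<in> \<Omega>" "y \<in> \<Omega>" "z \<in> \<Omega>"
  shows "prod x (y \<otimes> z) = prod x y \<otimes> prod x z"
proof -
  have "\<tau> x (y \<otimes> z) \<otimes> x = \<tau> x y \<otimes> \<tau> x z"
    using K_affine[of "\<tau> x" y z] assms by (simp add: \<tau>)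
  hence "(x \<otimes> x \<otimes> y \<otimes> z) \<otimes> prod x (y \<otimes> z) = (x \<otimes> x \<otimes> y \<otimes> z) \<otimes> (prod x y \<otimes> prod x z)"
    using assms by (simp add: \<tau>_prod prod_closed m_ac)
  thus ?thesis using assms by (simp add: prod_closed)
qed

text \<open>Associativity of the composition in \<open>H\<close>, expanded by biadditivity.\<close>

lemma prod_assoc:
  assumes "x \<in> \<Omega>" "y \<in> \<Omega>" "z \<in> \<Omega>"
  shows "prod (prod x y) z = prod x (prod y z)"
proof -
  have mult_prod: "prod (a \<otimes> b) z = prod a z \<otimes> prod b z" if "a \<in> \<Omega>" "b \<in> \<Omega>" for a b
    using prod_mult[of z a b] that assms by (simp add: prod_comm[of _ z])
  have "\<tau> (\<tau> x y) z = \<tau> x (\<tau> y z)"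
    using assms by (simp add: \<tau>_\<tau> compose_def)
  moreover have "\<tau> (\<tau> x y) z =
      (x \<otimes> y \<otimes> z \<otimes> prod x y \<otimes> prod x z \<otimes> prod y z) \<otimes> prod (prod x y) z"
    using assms by (simp add: \<tau>_prod prod_closed mult_prod m_ac)
  moreover have "\<tau> x (\<tau> y z) =
      (x \<otimes> y \<otimes> z \<otimes> prod x y \<otimes> prod x z \<otimes> prod y z) \<otimes> prod x (prod y z)"
    using assms by (simp add: \<tau>_prod prod_closed prod_mult m_ac)
  ultimately show ?thesis using assms by (simp add: prod_closed)
qed

text \<open>The hypothesis says \<open>\<tau> y x = y = \<tau> y \<one>\<close>.\<close>

lemma quasi_regular:
  assumes x: "x \<in> \<Omega>" and y: "y \<in> \<Omega>" and eq: "x \<otimes> prod x y = \<one>"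
  shows "x = \<one>"
proof -
  have "\<tau> y x = \<tau> y \<one>"
    using x y eq by (simp add: \<tau>_prod[of y x] prod_comm[of y x] \<tau> m_assoc prod_closed)
  moreover have "inj_on (\<tau> y) \<Omega>"
    using K_Bij[of "\<tau> y"] \<tau>[OF y] by (simp add: Bij_def bij_betw_def)
  ultimately show ?thesis using x by (auto dest: inj_onD)
qed

text \<open>The map \<open>f x = x \<otimes> \<phi> x\<close> lies in the 2-closure of \<open>K\<close>: for given \<open>x\<close> and \<open>y\<close>, the map that takes \<open>y\<close>
  to \<open>\<one>\<close> by a translation, applies \<open>\<tau> g\<close>, and takes \<open>g\<close> to \<open>f y\<close> by a translation also takes \<open>x\<close> to
  \<open>f x\<close>. Elements of \<open>K\<close> are affine, so \<open>\<phi>\<close> is additive.\<close>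

lemma rigid:
  assumes \<phi>: "\<phi> \<in> \<Omega> \<rightarrow> \<Omega>" and \<phi>1: "\<phi> \<one> = \<one>"
    and dom: "\<And>x y. \<lbrakk>x \<in> \<Omega>; y \<in> \<Omega>\<rbrakk> \<Longrightarrow> \<exists>g\<in>\<Omega>. \<phi> x \<otimes> inv \<phi> y = prod (x \<otimes> inv y) g"
    and a: "a \<in> \<Omega>" and b: "b \<in> \<Omega>"
  shows "\<phi> (a \<otimes> b) = \<phi> a \<otimes> \<phi> b"
proof -
  define f where "f = (\<lambda>x\<in>\<Omega>. x \<otimes> \<phi> x)"
  have \<phi>c [simp]: "\<phi> x \<in> \<Omega>" if "x \<in> \<Omega>" for x using \<phi> that by auto
  have fc [simp]: "f x \<in> \<Omega>" if "x \<in> \<Omega>" for x using that by (simp add: f_def)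
  have agree: "\<exists>k\<in>K. f x = k x \<and> f y = k y" if x: "x \<in> \<Omega>" and y: "y \<in> \<Omega>" for x y
  proof -
    obtain g where g: "g \<in> \<Omega>" "\<phi> x \<otimes> inv \<phi> y = prod (x \<otimes> inv y) g" using dom[OF x y] by blast
    let ?k = "compose \<Omega> (translation (f y \<otimes> inv g)) (compose \<Omega> (\<tau> g) (translation (inv y)))"
    have "?k \<in> K"
      using g y \<tau> by (intro subgroup_Bij_compose[OF K] translation_K) simp_all
    moreover have "?k y = f y"
      using g y by (simp add: compose_def translation_def \<tau> m_comm[of g] m_assoc)
    moreover have "?k x = f x"
    proof -
      have "\<tau> g (x \<otimes> inv y) = g \<otimes> (x \<otimes> inv y) \<otimes> (\<phi> x \<otimes> inv \<phi> y)"
        using g x y by (simp add: \<tau>_prod prod_comm[of g])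
      moreover have "?k x = \<tau> g (x \<otimes> inv y) \<otimes> (f y \<otimes> inv g)"
        using g x y by (simp add: compose_def translation_def)
      ultimately have "?k x = (g \<otimes> inv g) \<otimes> (inv y \<otimes> y) \<otimes> (inv \<phi> y \<otimes> \<phi> y) \<otimes> (x \<otimes> \<phi> x)"
        using g(1) x y by (simp add: f_def m_ac del: r_inv l_inv Units_r_inv Units_l_inv)
      thus ?thesis using g x y by (simp add: f_def)
    qed
    ultimately show ?thesis by metis
  qed
  have "inj_on f \<Omega>"
  proof (rule inj_onI)
    fix x y assume x: "x \<in> \<Omega>" and y: "y \<in> \<Omega>" and "f x = f y"
    moreover obtain k where "k \<in> K" "f x = k x" "f y = k y" using agree[OF x y] by blast
    ultimately show "x = y" using K_Bij[of k] by (auto simp: Bij_def bij_betw_def dest: inj_onD)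
  qed
  hence "bij_betw f \<Omega> \<Omega>"
    using fin by (simp add: bij_betw_def endo_inj_surj image_subsetI)
  hence "f \<in> Bij \<Omega>" by (simp add: Bij_def f_def)
  hence "f \<in> two_closure \<Omega> K"
    using agree unfolding two_closure_is_greatest(4)[OF K] by blast
  hence "f \<in> K" using K_closed by (simp add: two_closed_def)
  hence "f (a \<otimes> b) \<otimes> f \<one> = f a \<otimes> f b" using a b by (rule K_affine)
  hence "(a \<otimes> b) \<otimes> \<phi> (a \<otimes> b) = (a \<otimes> b) \<otimes> (\<phi> a \<otimes> \<phi> b)"
    using a b by (simp add: f_def \<phi>1 m_ac)
  thus ?thesis using a b by simp
qed

lemma circle_iso:
  "\<exists>h. bij_betw h \<Omega> \<Omega> \<and> (\<forall>x\<in>\<Omega>. \<forall>y\<in>\<Omega>. h (x \<otimes> y \<otimes> prod x y) = h x \<otimes> h y)"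
proof -
  obtain h where h: "bij_betw h H \<Omega>" "\<And>s t. s \<in> H \<Longrightarrow> t \<in> H \<Longrightarrow> h (compose \<Omega> s t) = h s \<otimes> h t"
    using H_iso by metis
  have "bij_betw \<tau> \<Omega> H"
    using \<tau> \<tau>_eqI by (intro bij_betw_byWitness[where f' = "\<lambda>t. t \<one>"]) auto
  hence "bij_betw (h \<circ> \<tau>) \<Omega> \<Omega>" using h(1) by (rule bij_betw_trans)
  moreover have "\<forall>x\<in>\<Omega>. \<forall>y\<in>\<Omega>. (h \<circ> \<tau>) (x \<otimes> y \<otimes> prod x y) = (h \<circ> \<tau>) x \<otimes> (h \<circ> \<tau>) y"
    using h(2) \<tau> by (simp add: \<tau>_\<tau> flip: \<tau>_prod)
  ultimately show ?thesis by blast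
qed

sublocale rigid_product G prod
  by unfold_locales
    (fact fin prod_closed prod_comm prod_mult prod_assoc quasi_regular rigid circle_iso)+

lemma H_eq_translations:
  assumes "\<And>x y. x \<in> \<Omega> \<Longrightarrow> y \<in> \<Omega> \<Longrightarrow> prod x y = \<one>"
  shows "H = right_translations G"
proof -
  have *: "\<tau> g = translation g" if g: "g \<in> \<Omega>" for g
  proof (rule extensionalityI)
    show "\<tau> g \<in> extensional \<Omega>" using \<tau>[OF g] K_Bij by (auto intro!: Bij_imp_extensional)
    show "translation g \<in> extensional \<Omega>" by (simp add: translation_def)
    show "\<tau> g x = translation g x" if "x \<in> \<Omega>" for x
      using g that assms by (simp add: \<tau>_prod translation_def m_comm)
  qed
  have "H = \<tau> ` \<Omega>"
  proof (intro equalityI subsetI)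
    fix t assume t: "t \<in> H"
    hence "t \<one> \<in> \<Omega>" "\<tau> (t \<one>) = t" using \<tau>_eqI by simp_all
    thus "t \<in> \<tau> ` \<Omega>" by force
  qed (use \<tau>(1) in blast)
  also have "\<dots> = right_translations G"
    using * by (auto simp: right_translations_def translation_def)
  finally show ?thesis .
qed

end

section \<open>Abelian groups with small Sylow subgroups\<close>

theorem corollary1p6:
  fixes G :: "('a, 'b) monoid_scheme" and n :: nat
  assumes "comm_group G"
    and "finite (carrier G)"
    and "order G = n"
    and "\<And>p P. Factorial_Ring.prime p \<Longrightarrow> p dvd n \<Longrightarrow> sylow_subgroup p P G \<Longrightarrow> card P \<le> p ^ 5"
    and "\<And>P. sylow_subgroup 2 P G \<Longrightarrow>
           G\<lparr>carrier := P\<rparr> \<cong> integer_mod_group 4 \<or>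
           (\<exists>k\<le>5::nat. G\<lparr>carrier := P\<rparr> \<cong> product_group {..<k} (\<lambda>_. integer_mod_group 2))"
  shows "NCI2_group G"
proof -
  interpret comm_group G by fact
  obtain P and m :: nat where P: "sylow_subgroup 2 P G" and m: "odd m"
    and mP: "\<And>g. g \<in> carrier G \<Longrightarrow> g [^]\<^bsub>G\<^esub> m \<in> P"
    using sylow_two[OF assms(2)] by metis
  have P_sub: "subgroup P G" using P by (simp add: sylow_subgroup_def)
  interpret GP: group "G\<lparr>carrier := P\<rparr>" using P_sub by (rule subgroup.subgroup_is_group) (rule group_axioms)
  have card_P: "card P \<le> 32"
  proof (cases "2 dvd n")
    case True
    thus ?thesis using assms(4)[OF two_is_prime_nat _ P] by simp
  next
    case False
    thus ?thesis using P assms(3) by (simp add: sylow_subgroup_def not_dvd_imp_multiplicity_0)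
  qed
  have unique: "H = right_translations G"
    if "regular_in_two_closed_holomorph G K H" for K H
  proof -
    interpret regular_in_two_closed_holomorph G K H by fact
    have "prod x y = \<one>\<^bsub>G\<^esub>" if xy: "x \<in> carrier G" "y \<in> carrier G" for x y
      using assms(5)[OF P]
    proof
      assume "G\<lparr>carrier := P\<rparr> \<cong> integer_mod_group 4"
      hence "integer_mod_group 4 \<cong> G\<lparr>carrier := P\<rparr>" by (rule GP.iso_sym)
      then obtain f where f: "f \<in> iso (integer_mod_group 4) (G\<lparr>carrier := P\<rparr>)"
        by (auto simp: is_iso_def)
      interpret f: group_hom "integer_mod_group 4" "G\<lparr>carrier := P\<rparr>" f
        using f by (simp add: group_hom_def group_hom_axioms_def iso_def GP.group_axioms)
      have bij: "bij_betw f {0..<4} P"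
        using f by (simp add: iso_def carrier_integer_mod_group)
      have pow: "f 1 [^]\<^bsub>G\<^esub> i = f (int i mod 4)" for i :: nat
        using f.hom_nat_pow[of 1 i] by (simp flip: nat_pow_consistent)
      have "f 1 \<in> P" using bij by (auto dest: bij_betwE)
      hence a: "f 1 \<in> carrier G" using subgroup.subset[OF P_sub] by blast
      have f0: "f 0 = \<one>\<^bsub>G\<^esub>" using f.hom_one by simp
      show ?thesis
      proof (rule prod_trivial_cyclic[OF m a _ _ _ xy])
        have "f 2 \<noteq> f 0"
          using bij by (auto dest!: bij_betw_imp_inj_on dest: inj_onD)
        thus "f 1 \<otimes>\<^bsub>G\<^esub> f 1 \<noteq> \<one>\<^bsub>G\<^esub>"
          using pow[of 2] a f0 by (simp add: numeral_eq_Suc)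
        show "f 1 [^]\<^bsub>G\<^esub> (4::nat) = \<one>\<^bsub>G\<^esub>" using pow[of 4] f0 by simp
        fix g assume "g \<in> carrier G"
        hence "g [^]\<^bsub>G\<^esub> m \<in> f ` {0..<4}" using mP bij by (simp add: bij_betw_def)
        then obtain j where j: "j \<in> {0..<4}" "g [^]\<^bsub>G\<^esub> m = f j" by blast
        thus "\<exists>i::nat. g [^]\<^bsub>G\<^esub> m = f 1 [^]\<^bsub>G\<^esub> i" using pow[of "nat j"] by (intro exI[of _ "nat j"]) simp
      qed
    next
      assume "\<exists>k\<le>5::nat. G\<lparr>carrier := P\<rparr> \<cong> product_group {..<k} (\<lambda>_. integer_mod_group 2)"
      then obtain k :: nat and f where
        f: "f \<in> iso (G\<lparr>carrier := P\<rparr>) (product_group {..<k} (\<lambda>_. integer_mod_group 2))"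
        by (auto simp: is_iso_def)
      interpret f: group_hom "G\<lparr>carrier := P\<rparr>" "product_group {..<k} (\<lambda>_. integer_mod_group 2)" f
        using f by (simp add: group_hom_def group_hom_axioms_def iso_def GP.group_axioms)
      have sq: "p \<otimes>\<^bsub>G\<^esub> p = \<one>\<^bsub>G\<^esub>" if p: "p \<in> P" for p
      proof -
        have pp: "p \<otimes>\<^bsub>G\<^esub> p \<in> P" using p P_sub by (simp add: subgroup.m_closed)
        have "f (p \<otimes>\<^bsub>G\<^esub> p) = (\<lambda>i\<in>{..<k}. (f p i + f p i) mod 2)"
          using f.hom_mult[of p p] p by simp
        also have "\<dots> = f \<one>\<^bsub>G\<^esub>"
          using f.hom_one by (auto simp: fun_eq_iff)
        finally show ?thesis
          using f pp subgroup.one_closed[OF P_sub]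
          by (auto simp: iso_def dest: bij_betw_imp_inj_on inj_onD)
      qed
      have pow_m: "g [^]\<^bsub>G\<^esub> m \<otimes>\<^bsub>G\<^esub> g [^]\<^bsub>G\<^esub> m = \<one>\<^bsub>G\<^esub>" if "g \<in> carrier G" for g
        using sq mP that by blast
      have "g \<in> P" if "g \<in> carrier G" "g \<otimes>\<^bsub>G\<^esub> g = \<one>\<^bsub>G\<^esub>" for g
        using mP[OF that(1)] pow_elementary[OF that] m by simp
      hence "card {g \<in> carrier G. g \<otimes>\<^bsub>G\<^esub> g = \<one>\<^bsub>G\<^esub>} \<le> card P"
        using subgroup.subset[OF P_sub] assms(2) by (intro card_mono) (auto intro: finite_subset)
      moreover have "g [^]\<^bsub>G\<^esub> (2 * m) = \<one>\<^bsub>G\<^esub>" if "g \<in> carrier G" for g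
        using pow_m[OF that] that by (simp add: nat_pow_mult mult_2)
      ultimately interpret small_alternating_product G prod m
        using m card_P pow_m prod_alternating[OF m] by unfold_locales auto
      show ?thesis using trivial xy by blast
    qed
    thus ?thesis by (rule H_eq_translations)
  qed
  have "G_transjugate G K"
    if K: "subgroup K (BijGroup (carrier G))" "two_closed (carrier G) K"
      "right_translations G \<subseteq> K" "K \<subseteq> holomorph G" for K
    unfolding G_transjugate_def
  proof (intro allI impI, elim conjE)
    fix H assume "H \<subseteq> K" "G_regular G H"
    \<comment> \<open>The translations are conjugate to themselves by the identity.\<close>
    hence eq: "H = right_translations G"
      using K assms(1,2)
      by (intro unique[of K] regular_in_two_closed_holomorph.intro
          regular_in_two_closed_holomorph_axioms.intro)
    interpret S: group "BijGroup (carrier G)" by (rule group_BijGroup)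
    have "right_translations G \<subseteq> carrier (BijGroup (carrier G))"
      using K(1,3) subgroup.subset by blast
    thus "\<exists>k\<in>K. H = k <#\<^bsub>BijGroup (carrier G)\<^esub> right_translations G
        #>\<^bsub>BijGroup (carrier G)\<^esub> inv\<^bsub>BijGroup (carrier G)\<^esub> k"
      using subgroup.one_closed[OF K(1)]
      by (intro bexI[of _ "\<one>\<^bsub>BijGroup (carrier G)\<^esub>"])
        (simp_all add: eq S.lcos_mult_one S.coset_mult_one del: BijGroup_simps)
  qed
  thus ?thesis using assms(2) group_axioms by (simp add: NCI2_group_def)
qed

end
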